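(* Assume conditions C1, C2a, C2b and C3, fix $\lambda>0$, and let $\widehat Y=\widehat Y_n\in L^\infty([0,T],\mathbb{R}^{d'})$ be an estimator of $Y^*$ that is consistent in probability in $L^2$, i.e. $\|\widehat Y_n-Y^*\|_{L^2}\to0$ in probability. Then the estimator $\widehat\theta^K=\arg\min_{\theta\in\Theta}S(\widehat Y;\theta,\lambda)$ satisfies $\widehat\theta^K\to\theta^*$ in probability.
   Context: Setting: $T>0$, $C\in\mathbb{R}^{d'\times d}$, $\Theta\subset\mathbb{R}^p$; for $\theta\in\Theta$, $A_\theta(t)\in\mathbb{R}^{d\times d}$, $r_\theta(t)\in\mathbb{R}^d$. $X_{\theta,x_0,u}$ solves $\dot x=A_\theta x+r_\theta+u$, $x(0)=x_0$; $X_{\theta,x_0}=X_{\theta,x_0,0}$. True parameter $\theta^*$, true initial condition $x_0^*$, $X^*=X_{\theta^*,x_0^*}$, $Y^*=CX^*$. Data $Y_i=CX^*(t_i)+\epsilon_i$, $i=1,\dots,n$, with random noise; $\widehat Y$ is a nonparametric estimator of $Y^*$ built from them. $S(Y;\theta,\lambda)=\inf_{x_0\in\mathbb{R}^d}\inf_{u\in L^2}\int_0^T(\|Y-CX_{\theta,x_0,u}\|_2^2+\lambda\|u\|_2^2)dt$ (i.e. with $Q=0$). $\Phi_\theta$ is the resolvent of $\dot x=A_\theta x$, $O_\theta(T)=\int_0^T\Phi_\theta(t,0)^TC^TC\Phi_\theta(t,0)dt$. Conditions: C1: $\Theta$ compact, $\theta^*$ in its interior. C2a: $O_\theta(T)$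 nonsingular for all $\theta\in\Theta$. C2b: for all $(\theta,x_0)\in\Theta\times\mathbb{R}^d$, $CX_{\theta,x_0}=CX_{\theta^*,x_0^*}$ implies $(\theta,x_0)=(\theta^*,x_0^* )$. C3: $(t,\theta)\mapsto A_\theta(t)$, $(t,\theta)\mapsto r_\theta(t)$ continuous on $[0,T]\times\Theta$. *)

theory Defs
  imports "HOL-Analysis.Analysis" "HOL-Probability.Probability"
begin

definition L2_on :: "real \<Rightarrow> (real \<Rightarrow> 'a::euclidean_space) set" where
  "L2_on T = {u. set_borel_measurable lborel {0..T} u \<and>
                 set_integrable lborel {0..T} (\<lambda>t. (norm (u t))\<^sup>2)}"

definition Linf_on :: "real \<Rightarrow> (real \<Rightarrow> 'a::euclidean_space) set" where
  "Linf_on T = {y. set_borel_measurable lborel {0..T} y \<and>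
                   (\<exists>B. AE t in lborel. t \<in> {0..T} \<longrightarrow> norm (y t) \<le> B)}"

definition L2norm_on :: "real \<Rightarrow> (real \<Rightarrow> 'a::euclidean_space) \<Rightarrow> real" where
  "L2norm_on T y = sqrt (LINT t:{0..T}|lborel. (norm (y t))\<^sup>2)"

text \<open>The (Caratheodory / integral-equation) solution X_{theta,x0,u} of
  x' = A_theta x + r_theta + u, x(0) = x0 on [0,T]; extended by 0 outside [0,T].\<close>
definition Xsol ::
  "real \<Rightarrow> ('p \<Rightarrow> real \<Rightarrow> real^'d^'d) \<Rightarrow> ('p \<Rightarrow> real \<Rightarrow> real^'d) \<Rightarrow>
   'p \<Rightarrow> real^'d \<Rightarrow> (real \<Rightarrow> real^'d) \<Rightarrow> real \<Rightarrow> real^'d" where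
  "Xsol T A r \<theta> x0 u = (THE x. continuous_on {0..T} x \<and>
      (\<forall>t\<in>{0..T}. ((\<lambda>s. A \<theta> s *v x s + r \<theta> s + u s) has_integral (x t - x0)) {0..t}) \<and>
      (\<forall>t. t \<notin> {0..T} \<longrightarrow> x t = 0))"

definition Phi0 ::
  "real \<Rightarrow> ('p \<Rightarrow> real \<Rightarrow> real^'d^'d) \<Rightarrow> 'p \<Rightarrow> real \<Rightarrow> real^'d^'d" where
  "Phi0 T A \<theta> = (THE F. continuous_on {0..T} F \<and>
      (\<forall>t\<in>{0..T}. ((\<lambda>s. A \<theta> s ** F s) has_integral (F t - mat 1)) {0..t}) \<and>
      (\<forall>t. t \<notin> {0..T} \<longrightarrow> F t = 0))"

definition Obs ::
  "real \<Rightarrow> real^'d^'d' \<Rightarrow> ('p \<Rightarrow> real \<Rightarrow> real^'d^'d) \<Rightarrow> 'p \<Rightarrow> real^'d^'d" where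
  "Obs T C A \<theta> = integral {0..T}
      (\<lambda>t. transpose (Phi0 T A \<theta> t) ** transpose C ** C ** Phi0 T A \<theta> t)"

definition cost ::
  "real \<Rightarrow> real^'d^'d' \<Rightarrow> ('p \<Rightarrow> real \<Rightarrow> real^'d^'d) \<Rightarrow> ('p \<Rightarrow> real \<Rightarrow> real^'d) \<Rightarrow>
   (real \<Rightarrow> real^'d') \<Rightarrow> 'p \<Rightarrow> real \<Rightarrow> real^'d \<Rightarrow> (real \<Rightarrow> real^'d) \<Rightarrow> real" where
  "cost T C A r Y \<theta> lam x0 u = (LINT t:{0..T}|lborel.
      (norm (Y t - C *v Xsol T A r \<theta> x0 u t))\<^sup>2 + lam * (norm (u t))\<^sup>2)"

definition Sfun ::
  "real \<Rightarrow> real^'d^'d' \<Rightarrow> ('p \<Rightarrow> real \<Rightarrow> real^'d^'d) \<Rightarrow> ('p \<Rightarrow> real \<Rightarrow> real^'d) \<Rightarrow>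
   (real \<Rightarrow> real^'d') \<Rightarrow> 'p \<Rightarrow> real \<Rightarrow> real" where
  "Sfun T C A r Y \<theta> lam = (INF x0\<in>UNIV. INF u\<in>L2_on T. cost T C A r Y \<theta> lam x0 u)"

end

(*
  At the true parameter the choice u = 0 gives S(Yhat) <= |Yhat - Y*|^2, so it suffices that the
  cost against the exact signal Y* stays above some delta > 0 when theta is far from the true
  parameter, uniformly in (x0, u). If not, there are far parameters theta_k, initial values x_k and
  controls u_k -> 0 in L^2 with C X_k - Y* -> 0 in L^2. Multiplying X_k by s_k = 1 / (1 + |x_k|)
  makes the data (theta_k, s_k, s_k x_k) relatively compact, and along a subsequence the scaled
  trajectories converge uniformly to the solution y of y' = A y + s r, y(0) = z, with C y = s Y*
  and s + |z| = 1. If s > 0, then y / s contradicts identifiability; if s = 0, then C Phi z = 0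
  with |z| = 1 contradicts invertibility of the observability Gramian.
*)
theory Submission
  imports Defs
begin

subsection \<open>Linear integral equations\<close>

text \<open>Randomness enters only through the L^2 distance of the estimate to the exact signal; the
  gap is deterministic, so consistency reduces to an inclusion of events for each n. The obstacle is
  uniformity of the gap: initial values range over an unbounded set and controls over an
  infinite-dimensional one. For the controls, the penalty weight \<open>lam > 0\<close> forces
  convergence to 0 in L^2, hence in L^1, and the L^1 norm of the forcing is what controls a solution
  uniformly on \<open>{0..T}\<close>. For the initial values, scaling keeps the equation linear but
  turns the source r into s r, so the limit result lets coefficients, source factor and initial
  value move simultaneously. Trajectories and resolvent are defined by definite description, hence
  existence and uniqueness must be available before anything can be said about them. Both are proved
  once for an abstract bilinear product, which covers matrix times vector and matrix times
  matrix.\<close>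

lemma has_integral_exp_mult:
  fixes K t :: real
  assumes "K > 0" "t \<ge> 0"
  shows "((\<lambda>s. exp (K * s)) has_integral (exp (K * t) - 1) / K) {0..t}"
proof -
  have "((\<lambda>s. exp (K * s)) has_integral (exp (K * t) / K - exp (K * 0) / K)) {0..t}"
    by (rule fundamental_theorem_of_calculus)
      (use assms in \<open>auto intro!: derivative_eq_intros
        simp: has_real_derivative_iff_has_vector_derivative[symmetric]\<close>)
  then show ?thesis by (simp add: diff_divide_distrib)
qed

text \<open>It is applied with c = 0 for uniqueness and with c tending to 0 for convergence. Only
  the proportionality to c matters there, so the factor 2 and the doubled exponent are
  harmless.\<close>

lemma weak_gronwall:
  fixes \<phi> :: "real \<Rightarrow> real"
  assumes T: "T \<ge> 0" and cont: "continuous_on {0..T} \<phi>" and b: "b > 0" and c: "c \<ge> 0"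
    and le: "\<And>t. t \<in> {0..T} \<Longrightarrow> \<phi> t \<le> c + b * integral {0..t} \<phi>"
    and t: "t \<in> {0..T}"
  shows "\<phi> t \<le> 2 * c * exp (2 * b * T)"
proof -
  \<comment> \<open>Maximising the weighted function makes the integral term absorb only half of the left-hand side.\<close>
  define \<psi> where "\<psi> t = exp (- (2 * b * t)) * \<phi> t" for t
  have "continuous_on {0..T} \<psi>"
    unfolding \<psi>_def by (intro continuous_intros cont)
  then obtain t0 where t0: "t0 \<in> {0..T}" and max: "\<And>s. s \<in> {0..T} \<Longrightarrow> \<psi> s \<le> \<psi> t0"
    using continuous_attains_sup[of "{0..T}" \<psi>] T by auto
  define m where "m = \<psi> t0"
  have \<phi>: "\<phi> s = \<psi> s * exp (2 * b * s)" for s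
    by (simp add: \<psi>_def exp_minus field_simps)
  have \<phi>_le: "\<phi> s \<le> m * exp (2 * b * s)" if "s \<in> {0..T}" for s
    using max[OF that] unfolding \<phi> m_def by (intro mult_right_mono) auto
  show ?thesis
  proof (cases "m \<le> 0")
    case True
    then have "m * exp (2 * b * t) \<le> 0" by (simp add: mult_nonpos_nonneg)
    moreover have "0 \<le> 2 * c * exp (2 * b * T)" using c by simp
    ultimately show ?thesis using \<phi>_le[OF t] by linarith
  next
    case False
    have "integral {0..t0} \<phi> \<le> m * ((exp (2 * b * t0) - 1) / (2 * b))"
    proof (rule has_integral_le)
      show "(\<phi> has_integral integral {0..t0} \<phi>) {0..t0}"
        using t0 by (intro integrable_integral integrable_continuous_real
            continuous_on_subset[OF cont]) auto
      show "((\<lambda>s. m * exp (2 * b * s)) has_integral m * ((exp (2 * b * t0) - 1) / (2 * b))) {0..t0}"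
        using b t0 by (intro has_integral_mult_right has_integral_exp_mult) auto
      show "\<phi> s \<le> m * exp (2 * b * s)" if "s \<in> {0..t0}" for s
        using that t0 by (intro \<phi>_le) auto
    qed
    then have "b * integral {0..t0} \<phi> \<le> b * (m * ((exp (2 * b * t0) - 1) / (2 * b)))"
      using b by (intro mult_left_mono) auto
    also have "\<dots> = m * (exp (2 * b * t0) - 1) / 2" using b by simp
    finally have "m * exp (2 * b * t0) \<le> c + m * (exp (2 * b * t0) - 1) / 2"
      using le[OF t0] by (simp add: \<phi> m_def)
    then have "m * exp (2 * b * t0) \<le> 2 * c"
      using False by (simp add: field_simps)
    moreover have "m * 1 \<le> m * exp (2 * b * t0)"
      using False b t0 by (intro mult_left_mono) auto
    ultimately have "m \<le> 2 * c" by simp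
    have "m * exp (2 * b * t) \<le> (2 * c) * exp (2 * b * T)"
      using \<open>m \<le> 2 * c\<close> False c b t by (intro mult_mono) auto
    then show ?thesis using \<phi>_le[OF t] by linarith
  qed
qed

section \<open>Existence, stability and uniqueness for linear integral equations\<close>

text \<open>The inhomogeneity is a continuous function G instead of an integrated source: a merely
  integrable control enters through its indefinite integral, and the fixed point problem stays among
  continuous functions.\<close>

lemma integral_equation_solution_exists:
  fixes pr :: "'b::real_normed_vector \<Rightarrow> 'a \<Rightarrow> 'a::euclidean_space" and A :: "real \<Rightarrow> 'b" and G :: "real \<Rightarrow> 'a"
  assumes bb: "bounded_bilinear pr" and T: "T \<ge> 0"
    and A: "continuous_on {0..T} A" and G: "continuous_on {0..T} G"
  shows "\<exists>y. continuous_on {0..T} y \<and>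
    (\<forall>t\<in>{0..T}. ((\<lambda>s. pr (A s) (y s)) has_integral (y t - G t)) {0..t})"
proof -
  interpret bounded_bilinear "pr :: 'b \<Rightarrow> 'a \<Rightarrow> 'a" by (rule bb)
  obtain k where k: "k > 0" "\<And>x y. norm (pr x y) \<le> norm x * norm y * k"
    using pos_bounded by blast
  obtain a where a: "a > 0" "\<And>s. s \<in> {0..T} \<Longrightarrow> norm (A s) \<le> a"
    using compact_imp_bounded[OF compact_continuous_image[OF A compact_Icc]]
    unfolding bounded_pos by auto
  \<comment> \<open>With respect to the weight exp (- K t) the integral operator is a contraction with constant 1/2.\<close>
  define K where "K = 2 * a * k"
  have K: "K > 0" using a k by (simp add: K_def)
  \<comment> \<open>The unknown of the fixed point problem is z t = exp (- K t) y t. This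
    substitution turns the weighted norm into the plain supremum norm.\<close>
  define h where "h z s = pr (A s) (exp (K * s) *\<^sub>R z s)" for z and s
  define P where "P z t = exp (- (K * t)) *\<^sub>R (G t + integral {0..t} (h z))" for z t
  have h_cont: "continuous_on {0..T} (h z)" if "continuous_on {0..T} z" for z
    unfolding h_def by (intro continuous_intros continuous_on A that)
  have h_int: "h z integrable_on {0..t}" if "continuous_on {0..T} z" "t \<in> {0..T}" for z t
    using that by (intro integrable_continuous_real continuous_on_subset[OF h_cont]) auto
  have P_cont: "continuous_on {0..T} (P z)" if "continuous_on {0..T} z" for z
    unfolding P_def using h_int[OF that, of T] T
    by (intro continuous_intros G indefinite_integral_continuous_1) auto
  \<comment> \<open>Bounded continuous functions on the whole line serve as the complete space;
    \<open>ext_cont\<close> freezes the values beyond the end points of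
    \<open>{0..T}\<close>.\<close>
  define F :: "(real \<Rightarrow>\<^sub>C 'a) \<Rightarrow> (real \<Rightarrow>\<^sub>C 'a)"
    where "F z = Bcontfun (ext_cont (P z) 0 T)" for z
  have F: "apply_bcontfun (F z) = ext_cont (P z) 0 T" for z
  proof -
    have "range (ext_cont (P z) 0 T) \<subseteq> P z ` {0..T}"
    proof (rule image_subsetI)
      fix x have "clamp 0 T x \<in> {0..T}" using clamp_in_interval[of 0 T x] T by auto
      then show "ext_cont (P z) 0 T x \<in> P z ` {0..T}" unfolding ext_cont_def by (rule imageI)
    qed
    moreover have "bounded (P z ` {0..T})"
      by (intro compact_imp_bounded compact_continuous_image P_cont) auto
    moreover have "continuous_on UNIV (ext_cont (P z) 0 T)"
      by (rule continuous_on_ext_cont) (use P_cont in auto)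
    ultimately have "ext_cont (P z) 0 T \<in> bcontfun" 
      unfolding bcontfun_def by (metis (no_types, lifting) bounded_subset mem_Collect_eq)
    then show ?thesis by (simp add: F_def Bcontfun_inverse)
  qed
  have lip: "norm (P z t - P w t) \<le> (1/2) * dist z w" if t: "t \<in> {0..T}" for z w :: "real \<Rightarrow>\<^sub>C 'a" and t
  proof -
    have hz: "h (apply_bcontfun z) integrable_on {0..t}" and hw: "h (apply_bcontfun w) integrable_on {0..t}"
      using h_int t by auto
    have "norm (integral {0..t} (\<lambda>s. h z s - h w s))
        \<le> integral {0..t} (\<lambda>s. (a * k * dist z w) * exp (K * s))"
    proof (rule integral_norm_bound_integral)
      show "(\<lambda>s. h z s - h w s) integrable_on {0..t}" using hz hw by (rule integrable_diff)
      show "(\<lambda>s. (a * k * dist z w) * exp (K * s)) integrable_on {0..t}"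
        by (intro integrable_continuous_real continuous_intros)
      fix s assume s: "s \<in> {0..t}"
      have "norm (h z s - h w s) = norm (pr (A s) (exp (K * s) *\<^sub>R (z s - w s)))"
        by (simp add: h_def diff_right scaleR_diff_right)
      also have "\<dots> \<le> norm (A s) * norm (exp (K * s) *\<^sub>R (z s - w s)) * k" by (rule k)
      also have "\<dots> \<le> a * (exp (K * s) * dist z w) * k"
        using a(2)[of s] a(1) k s t dist_bounded[of z s w]
        by (intro mult_mono mult_nonneg_nonneg) (auto simp: dist_norm)
      finally show "norm (h z s - h w s) \<le> (a * k * dist z w) * exp (K * s)" by (simp add: ac_simps)
    qed
    also have "\<dots> = (a * k * dist z w) * ((exp (K * t) - 1) / K)"
      using has_integral_mult_right[OF has_integral_exp_mult[OF K, of t], of "a * k * dist z w"] t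
      by (intro integral_unique) auto
    also have "\<dots> = (1/2) * dist z w * (exp (K * t) - 1)"
      using a k by (simp add: K_def)
    also have "\<dots> \<le> (1/2) * dist z w * exp (K * t)"
      by (intro mult_left_mono) auto
    finally have le: "norm (integral {0..t} (\<lambda>s. h z s - h w s)) \<le> (1/2) * dist z w * exp (K * t)" .
    have "norm (P z t - P w t) = exp (- (K * t)) * norm (integral {0..t} (\<lambda>s. h z s - h w s))"
      by (simp add: P_def scaleR_diff_right[symmetric] integral_diff[OF hz hw])
    also have "\<dots> \<le> exp (- (K * t)) * ((1/2) * dist z w * exp (K * t))"
      by (rule mult_left_mono[OF le]) simp
    also have "\<dots> = (1/2) * dist z w"
      by (simp add: exp_minus)
    finally show ?thesis .
  qed
  have "\<exists>!z. F z = z"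
  proof (rule banach_fix_type[of "1/2"])
    show "\<forall>z w. dist (F z) (F w) \<le> (1/2) * dist z w"
    proof (intro allI dist_bound)
      fix z w :: "real \<Rightarrow>\<^sub>C 'a" and x
      have "clamp 0 T x \<in> {0..T}" using clamp_in_interval[of 0 T x] T by auto
      from lip[OF this, of z w] show "dist (F z x) (F w x) \<le> (1/2) * dist z w"
        by (simp add: F ext_cont_def dist_norm)
    qed
  qed auto
  then obtain z where z: "F z = z" by blast
  have zP: "z t = P z t" if "t \<in> {0..T}" for t
    using that z F[of z] ext_cont_cancel_cbox[of t 0 T "P z"] by simp
  define y where "y t = exp (K * t) *\<^sub>R z t" for t
  have "y t - G t = integral {0..t} (h z)" if "t \<in> {0..T}" for t
    using zP[OF that] by (simp add: y_def P_def exp_minus)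
  moreover have "(h z has_integral integral {0..t} (h z)) {0..t}" if "t \<in> {0..T}" for t
    using h_int[OF _ that] by (intro integrable_integral) auto
  moreover have "h z = (\<lambda>s. pr (A s) (y s))" by (simp add: h_def y_def fun_eq_iff)
  moreover have "continuous_on {0..T} y" unfolding y_def by (intro continuous_intros) auto
  ultimately show ?thesis by (intro exI[of _ y]) auto
qed

text \<open>Values outside \<open>{0..T}\<close> are left free here, whereas \<open>Xsol\<close> and
  \<open>Phi0\<close> fix them to be 0. The product \<open>pr\<close> is a parameter because the
  state equation and the resolvent equation share this form.\<close>

definition solves_linear ::
  "('b \<Rightarrow> 'a \<Rightarrow> 'a) \<Rightarrow> real \<Rightarrow> (real \<Rightarrow> 'b) \<Rightarrow> (real \<Rightarrow> 'a) \<Rightarrow> 'a \<Rightarrow> (real \<Rightarrow> 'a::euclidean_space) \<Rightarrow> bool" where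
  "solves_linear pr T A g x0 y \<longleftrightarrow> continuous_on {0..T} y \<and>
    (\<forall>t\<in>{0..T}. ((\<lambda>s. pr (A s) (y s) + g s) has_integral (y t - x0)) {0..t})"

lemma solves_linear_exists:
  fixes pr :: "'b::real_normed_vector \<Rightarrow> 'a \<Rightarrow> 'a::euclidean_space" and A :: "real \<Rightarrow> 'b" and g :: "real \<Rightarrow> 'a"
  assumes bb: "bounded_bilinear pr" and T: "T \<ge> 0"
    and A: "continuous_on {0..T} A" and g: "g integrable_on {0..T}"
  shows "\<exists>y. solves_linear pr T A g x0 y"
proof -
  have "continuous_on {0..T} (\<lambda>t. x0 + integral {0..t} g)"
    by (intro continuous_intros indefinite_integral_continuous_1 g)
  from integral_equation_solution_exists[OF bb T A this] obtain y where y: "continuous_on {0..T} y"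
    "\<And>t. t \<in> {0..T} \<Longrightarrow> ((\<lambda>s. pr (A s) (y s)) has_integral (y t - (x0 + integral {0..t} g))) {0..t}"
    by blast
  have "((\<lambda>s. pr (A s) (y s) + g s) has_integral (y t - x0)) {0..t}" if "t \<in> {0..T}" for t
  proof -
    have "(g has_integral integral {0..t} g) {0..t}"
      using that by (intro integrable_integral integrable_on_subinterval[OF g]) auto
    from has_integral_add[OF y(2)[OF that] this] show ?thesis by (simp add: algebra_simps)
  qed
  with y show ?thesis unfolding solves_linear_def by blast
qed

text \<open>Gronwall for the norm of y - z, after splitting the difference of the right-hand sides
  into A (y - z) and the defect (A - B) z + (g - h). The asymmetry is deliberate: the defect
  involves only z, so z can be a fixed limit while y runs through a sequence without known bounds.
  The bound \<open>e\<close> is only integrable, which admits unbounded controls.\<close>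

lemma solves_linear_stability:
  fixes pr :: "'b::real_normed_vector \<Rightarrow> 'a \<Rightarrow> 'a::euclidean_space" and A B :: "real \<Rightarrow> 'b" and g :: "real \<Rightarrow> 'a"
  assumes bb: "bounded_bilinear pr" and T: "T \<ge> 0"
    and k: "k > 0" "\<And>x y. norm (pr x y) \<le> norm x * norm y * k"
    and a: "a > 0" "\<And>s. s \<in> {0..T} \<Longrightarrow> norm (A s) \<le> a"
    and y: "solves_linear pr T A g x y" and z: "solves_linear pr T B h x' z"
    and e: "e integrable_on {0..T}"
    and le: "\<And>s. s \<in> {0..T} \<Longrightarrow> norm (pr (A s - B s) (z s) + (g s - h s)) \<le> e s"
    and t: "t \<in> {0..T}"
  shows "norm (y t - z t) \<le> 2 * (norm (x - x') + integral {0..T} e) * exp (2 * (a * k) * T)"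
proof (rule weak_gronwall[OF T, where \<phi> = "\<lambda>t. norm (y t - z t)"])
  interpret bounded_bilinear "pr :: 'b \<Rightarrow> 'a \<Rightarrow> 'a" by (rule bb)
  have e0: "e s \<ge> 0" if "s \<in> {0..T}" for s
    using order_trans[OF norm_ge_zero le[OF that]] .
  show cont: "continuous_on {0..T} (\<lambda>t. norm (y t - z t))"
    using y z unfolding solves_linear_def by (intro continuous_intros) auto
  show "0 < a * k" using a k by simp
  show "0 \<le> norm (x - x') + integral {0..T} e"
    using e0 by (intro add_nonneg_nonneg integral_nonneg e) auto
  fix t assume t: "t \<in> {0..T}"
  have d: "((\<lambda>s. (pr (A s) (y s) + g s) - (pr (B s) (z s) + h s)) has_integral
      ((y t - x) - (z t - x'))) {0..t}"
    using y z t unfolding solves_linear_def by (intro has_integral_diff) auto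
  have et: "e integrable_on {0..t}"
    using t by (intro integrable_on_subinterval[OF e]) auto
  have nt: "(\<lambda>s. norm (y s - z s)) integrable_on {0..t}"
    using t by (intro integrable_continuous_real continuous_on_subset[OF cont]) auto
  have "norm (integral {0..t} (\<lambda>s. (pr (A s) (y s) + g s) - (pr (B s) (z s) + h s)))
      \<le> integral {0..t} (\<lambda>s. a * k * norm (y s - z s) + e s)"
  proof (rule integral_norm_bound_integral)
    show "(\<lambda>s. (pr (A s) (y s) + g s) - (pr (B s) (z s) + h s)) integrable_on {0..t}"
      using d by blast
    show "(\<lambda>s. a * k * norm (y s - z s) + e s) integrable_on {0..t}"
      by (intro integrable_add et integrable_on_mult_right nt)
    fix s assume s: "s \<in> {0..t}"
    have "(pr (A s) (y s) + g s) - (pr (B s) (z s) + h s)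
        = pr (A s) (y s - z s) + (pr (A s - B s) (z s) + (g s - h s))"
      by (simp add: diff_left diff_right)
    moreover have "norm (pr (A s) (y s - z s)) \<le> a * norm (y s - z s) * k"
      using k a(1) a(2)[of s] s t
      by (intro order_trans[OF k(2)] mult_right_mono) auto
    moreover have "norm (pr (A s - B s) (z s) + (g s - h s)) \<le> e s"
      using s t by (intro le) auto
    ultimately show "norm ((pr (A s) (y s) + g s) - (pr (B s) (z s) + h s))
        \<le> a * k * norm (y s - z s) + e s"
      using norm_triangle_ineq[of "pr (A s) (y s - z s)" "pr (A s - B s) (z s) + (g s - h s)"]
        mult.commute[of k "a * norm (y s - z s)"] by (simp only: mult.assoc mult.left_commute)
  qed
  also have "\<dots> = a * k * integral {0..t} (\<lambda>s. norm (y s - z s)) + integral {0..t} e"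
    by (subst integral_add) (auto intro!: integrable_on_mult_right nt et)
  also have "integral {0..t} e \<le> integral {0..T} e"
    using t e0 by (intro integral_subset_le et e) auto
  finally have "norm ((y t - x) - (z t - x')) \<le> a * k * integral {0..t} (\<lambda>s. norm (y s - z s)) + integral {0..T} e"
    using integral_unique[OF d] by simp
  moreover have "norm (y t - z t) \<le> norm ((y t - x) - (z t - x')) + norm (x - x')"
    using norm_triangle_ineq[of "(y t - x) - (z t - x')" "x - x'"] by (simp add: algebra_simps)
  ultimately show "norm (y t - z t) \<le> norm (x - x') + integral {0..T} e
      + a * k * integral {0..t} (\<lambda>s. norm (y s - z s))" by simp
qed (rule t)

lemma solves_linear_unique:
  fixes pr :: "'b::real_normed_vector \<Rightarrow> 'a \<Rightarrow> 'a::euclidean_space" and A :: "real \<Rightarrow> 'b" and g :: "real \<Rightarrow> 'a"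
  assumes bb: "bounded_bilinear pr" and T: "T \<ge> 0" and A: "continuous_on {0..T} A"
    and y: "solves_linear pr T A g x y" and z: "solves_linear pr T A g x z"
    and t: "t \<in> {0..T}"
  shows "y t = z t"
proof -
  interpret bounded_bilinear "pr :: 'b \<Rightarrow> 'a \<Rightarrow> 'a" by (rule bb)
  obtain k where k: "k > 0" "\<And>x y. norm (pr x y) \<le> norm x * norm y * k"
    using pos_bounded by blast
  obtain a where a: "a > 0" "\<And>s. s \<in> {0..T} \<Longrightarrow> norm (A s) \<le> a"
    using compact_imp_bounded[OF compact_continuous_image[OF A compact_Icc]]
    unfolding bounded_pos by auto
  have "norm (y t - z t) \<le> 2 * (norm (x - x) + integral {0..T} (\<lambda>_. 0)) * exp (2 * (a * k) * T)"
    by (rule solves_linear_stability[OF bb T k a y z]) (use t zero_left in auto)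
  then show ?thesis by simp
qed

text \<open>Fixing the value 0 outside \<open>{0..T}\<close> makes the solution unique as a function
  on the whole line, as the definite descriptions in \<open>Xsol\<close> and \<open>Phi0\<close>
  require.\<close>

lemma solves_linear_ex1_zero_outside:
  fixes pr :: "'b::real_normed_vector \<Rightarrow> 'a \<Rightarrow> 'a::euclidean_space" and A :: "real \<Rightarrow> 'b" and g :: "real \<Rightarrow> 'a"
  assumes bb: "bounded_bilinear pr" and T: "T \<ge> 0"
    and A: "continuous_on {0..T} A" and g: "g integrable_on {0..T}"
  shows "\<exists>!y. solves_linear pr T A g x0 y \<and> (\<forall>t. t \<notin> {0..T} \<longrightarrow> y t = 0)"
proof -
  obtain y where y: "solves_linear pr T A g x0 y"
    using solves_linear_exists[OF assms] by blast
  define y' where "y' t = (if t \<in> {0..T} then y t else 0)" for t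
  have "continuous_on {0..T} y'"
    using y by (subst continuous_on_cong[OF refl, of _ _ y]) (auto simp: y'_def solves_linear_def)
  moreover have "((\<lambda>s. pr (A s) (y' s) + g s) has_integral (y' t - x0)) {0..t}" if "t \<in> {0..T}" for t
    using that y by (subst has_integral_cong[of _ _ "\<lambda>s. pr (A s) (y s) + g s"])
      (auto simp: y'_def solves_linear_def)
  ultimately have "solves_linear pr T A g x0 y'"
    by (auto simp: solves_linear_def)
  then show ?thesis
  proof (intro ex1I[of _ y'] conjI)
    fix z assume z: "solves_linear pr T A g x0 z \<and> (\<forall>t. t \<notin> {0..T} \<longrightarrow> z t = 0)"
    then show "z = y'"
      using solves_linear_unique[OF bb T A, of g x0 z y] y by (auto simp: y'_def fun_eq_iff)
  qed (auto simp: y'_def)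
qed

lemma solves_linear_scaleR:
  assumes "bounded_bilinear pr" "solves_linear pr T A g x y"
  shows "solves_linear pr T A (\<lambda>s. c *\<^sub>R g s) (c *\<^sub>R x) (\<lambda>s. c *\<^sub>R y s)"
proof -
  interpret bounded_bilinear pr by (rule assms)
  have "((\<lambda>s. c *\<^sub>R (pr (A s) (y s) + g s)) has_integral c *\<^sub>R (y t - x)) {0..t}" if "t \<in> {0..T}" for t
    using assms(2) that by (intro has_integral_cmul) (auto simp: solves_linear_def)
  then show ?thesis
    using assms(2) unfolding solves_linear_def
    by (auto simp: scaleR_right scaleR_add_right scaleR_diff_right intro!: continuous_intros)
qed

section \<open>Matrix products and continuous dependence on the parameter\<close>

lemma bounded_bilinear_matrix_vector_mult:
  "bounded_bilinear ((*v) :: real^'n^'m \<Rightarrow> real^'n \<Rightarrow> real^'m)"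
  unfolding bilinear_conv_bounded_bilinear[symmetric] bilinear_def
proof (intro conjI allI)
  fix x :: "real^'n"
  show "linear (\<lambda>A :: real^'n^'m. A *v x)"
    by (rule linearI) (simp_all add: matrix_vector_mult_add_rdistrib scaleR_matrix_vector_assoc)
qed (rule matrix_vector_mul_linear)

lemma bounded_bilinear_matrix_matrix_mult:
  "bounded_bilinear ((**) :: real^'n^'m \<Rightarrow> real^'k^'n \<Rightarrow> real^'k^'m)"
  unfolding bilinear_conv_bounded_bilinear[symmetric] bilinear_def
  by (intro conjI allI linearI)
    (simp_all add: vec_eq_iff matrix_matrix_mult_def sum.distrib algebra_simps sum_distrib_left)

lemmas continuous_on_matrix_vector [continuous_intros] =
  bounded_bilinear.continuous_on[OF bounded_bilinear_matrix_vector_mult]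

lemmas continuous_on_matrix_matrix [continuous_intros] =
  bounded_bilinear.continuous_on[OF bounded_bilinear_matrix_matrix_mult]

text \<open>Joint continuity on a compact product is uniform, so a small move of the parameter
  changes the whole function of t by little at once.\<close>

lemma uniform_limit_parameter:
  fixes f :: "'a::metric_space \<Rightarrow> 'b::metric_space \<Rightarrow> 'c::metric_space"
  assumes S: "compact S" and \<Theta>: "compact \<Theta>"
    and f: "continuous_on (S \<times> \<Theta>) (\<lambda>(t, \<theta>). f \<theta> t)"
    and \<theta>: "\<And>k. \<theta> k \<in> \<Theta>" "\<theta>' \<in> \<Theta>" "\<theta> \<longlonglongrightarrow> \<theta>'"
  shows "uniform_limit S (\<lambda>k. f (\<theta> k)) (f \<theta>') sequentially"
proof (rule uniform_limitI)
  fix e :: real assume "e > 0"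
  have "uniformly_continuous_on (S \<times> \<Theta>) (\<lambda>(t, \<theta>). f \<theta> t)"
    by (intro compact_uniformly_continuous f compact_Times S \<Theta>)
  then obtain d where d: "d > 0" and close: "\<And>p q. p \<in> S \<times> \<Theta> \<Longrightarrow> q \<in> S \<times> \<Theta> \<Longrightarrow> dist q p < d
      \<Longrightarrow> dist (case q of (t, \<theta>) \<Rightarrow> f \<theta> t) (case p of (t, \<theta>) \<Rightarrow> f \<theta> t) < e"
    using \<open>e > 0\<close> unfolding uniformly_continuous_on_def by metis
  have "\<forall>\<^sub>F k in sequentially. dist (\<theta> k) \<theta>' < d" using \<theta>(3) d by (rule tendstoD)
  then show "\<forall>\<^sub>F k in sequentially. \<forall>t\<in>S. dist (f (\<theta> k) t) (f \<theta>' t) < e"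
  proof eventually_elim
    case (elim k)
    show ?case
    proof
      fix t assume "t \<in> S"
      then show "dist (f (\<theta> k) t) (f \<theta>' t) < e"
        using close[of "(t, \<theta>')" "(t, \<theta> k)"] \<theta> elim by (simp add: dist_Pair_Pair)
    qed
  qed
qed

lemma continuous_on_parameter_section:
  assumes "continuous_on (S \<times> \<Theta>) (\<lambda>(t, \<theta>). f \<theta> t)" "\<theta> \<in> \<Theta>"
  shows "continuous_on S (f \<theta>)"
proof -
  have "continuous_on S (\<lambda>t. (t, \<theta>))" by (intro continuous_intros)
  from continuous_on_compose2[OF assms(1) this] assms(2) show ?thesis by auto
qed

text \<open>Coefficients and source converge uniformly in t, while the forcing v tends to 0 only in
  L^1 and has no pointwise bound. The stability estimate therefore gets as dominating function a
  small constant plus the norm of v.\<close>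

lemma solves_linear_limit:
  fixes A :: "'p::metric_space \<Rightarrow> real \<Rightarrow> real^'d^'d" and r :: "'p \<Rightarrow> real \<Rightarrow> real^'d"
  assumes T: "T > 0" and \<Theta>: "compact \<Theta>"
    and A: "continuous_on ({0..T} \<times> \<Theta>) (\<lambda>(t, \<theta>). A \<theta> t)"
    and r: "continuous_on ({0..T} \<times> \<Theta>) (\<lambda>(t, \<theta>). r \<theta> t)"
    and \<theta>: "\<And>k. \<theta> k \<in> \<Theta>" "\<theta>' \<in> \<Theta>" "\<theta> \<longlonglongrightarrow> \<theta>'"
    and s: "s \<longlonglongrightarrow> s'" and x: "x \<longlonglongrightarrow> x'"
    and v: "\<And>k. (\<lambda>t. norm (v k t)) integrable_on {0..T}"
      "(\<lambda>k. integral {0..T} (\<lambda>t. norm (v k t))) \<longlonglongrightarrow> 0"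
    and y: "\<And>k. solves_linear (*v) T (A (\<theta> k)) (\<lambda>t. s k *\<^sub>R r (\<theta> k) t + v k t) (x k) (y k)"
    and y': "solves_linear (*v) T (A \<theta>') (\<lambda>t. s' *\<^sub>R r \<theta>' t) x' y'"
  shows "uniform_limit {0..T} y y' sequentially"
proof (rule uniform_limitI)
  fix e :: real assume e: "e > 0"
  note bb = bounded_bilinear_matrix_vector_mult
  interpret mv: bounded_bilinear "(*v) :: real^'d^'d \<Rightarrow> real^'d \<Rightarrow> real^'d" by (rule bb)
  obtain \<kappa> where \<kappa>: "\<kappa> > 0" "\<And>(M :: real^'d^'d) w. norm (M *v w) \<le> norm M * norm w * \<kappa>"
    using mv.pos_bounded by blast
  \<comment> \<open>One bound for all parameters keeps the exponential factor of the stability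
    estimate the same along the sequence.\<close>
  have "bounded ((\<lambda>(t, \<theta>). A \<theta> t) ` ({0..T} \<times> \<Theta>))"
    by (intro compact_imp_bounded compact_continuous_image A compact_Times \<Theta> compact_Icc)
  then obtain a where a: "a > 0" and a': "\<forall>v \<in> (\<lambda>(t, \<theta>). A \<theta> t) ` ({0..T} \<times> \<Theta>). norm v \<le> a"
    unfolding bounded_pos by blast
  have A_le: "norm (A (\<theta> k) t) \<le> a" if "t \<in> {0..T}" for k t
    using bspec[OF a', of "A (\<theta> k) t"] that \<theta>(1)[of k] by force
  have y'_cont: "continuous_on {0..T} y'" using y' by (simp add: solves_linear_def)
  have bdd: "bounded (y' ` {0..T})" "bounded (A \<theta>' ` {0..T})" "bounded (r \<theta>' ` {0..T})"
    by (intro compact_imp_bounded compact_continuous_image y'_cont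
        continuous_on_parameter_section[OF A \<theta>(2)] continuous_on_parameter_section[OF r \<theta>(2)] compact_Icc)+
  \<comment> \<open>\<open>D k\<close> is the defect of the limit y' in the k-th equation without
    its forcing \<open>v k\<close>.\<close>
  define D where "D k t = (A (\<theta> k) t - A \<theta>' t) *v y' t + (s k *\<^sub>R r (\<theta> k) t - s' *\<^sub>R r \<theta>' t)" for k t
  have "uniform_limit {0..T} (\<lambda>k t. A (\<theta> k) t *v y' t + s k *\<^sub>R r (\<theta> k) t)
      (\<lambda>t. A \<theta>' t *v y' t + s' *\<^sub>R r \<theta>' t) sequentially"
  proof (intro uniform_limit_add)
    show "uniform_limit {0..T} (\<lambda>k t. A (\<theta> k) t *v y' t) (\<lambda>t. A \<theta>' t *v y' t) sequentially"
      by (intro mv.bounded_uniform_limit uniform_limit_parameter[OF compact_Icc \<Theta> A \<theta>]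
          uniform_limit_const bdd)
    show "uniform_limit {0..T} (\<lambda>k t. s k *\<^sub>R r (\<theta> k) t) (\<lambda>t. s' *\<^sub>R r \<theta>' t) sequentially"
      using s T by (intro bounded_bilinear.bounded_uniform_limit[OF bounded_bilinear_scaleR]
          uniform_limit_parameter[OF compact_Icc \<Theta> r \<theta>] bdd)
        (auto simp: uniform_limit_iff tendsto_iff image_constant_conv)
  qed
  then have D: "\<forall>\<^sub>F k in sequentially. \<forall>t\<in>{0..T}. norm (D k t) < d" if "d > 0" for d
    using that unfolding uniform_limit_iff D_def
    by (auto simp: dist_norm mv.diff_left algebra_simps)
  define E where "E = exp (2 * (a * \<kappa>) * T)"
  have E: "E > 0" by (simp add: E_def)
  \<comment> \<open>The stability estimate will stay below 2 (d + d T) E, where d T is the integral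
    of the constant d; this choice turns it into e / 2.\<close>
  define d where "d = e / (4 * E) / (1 + T)"
  have d: "d > 0" using e T E by (simp add: d_def)
  have "(\<lambda>k. norm (x k - x') + integral {0..T} (\<lambda>t. norm (v k t))) \<longlonglongrightarrow> 0"
    using tendsto_add[OF tendsto_norm_zero[OF LIM_zero[OF x]] v(2)] by simp
  then have "\<forall>\<^sub>F k in sequentially. norm (x k - x') + integral {0..T} (\<lambda>t. norm (v k t)) < d"
    using d by (rule order_tendstoD)
  with D[OF d] show "\<forall>\<^sub>F k in sequentially. \<forall>t\<in>{0..T}. dist (y k t) (y' t) < e"
  proof eventually_elim
    case (elim k)
    show ?case
    proof
      fix t assume t: "t \<in> {0..T}"
      have "norm (y k t - y' t) \<le> 2 * (norm (x k - x') + integral {0..T} (\<lambda>t. d + norm (v k t))) * E"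
        unfolding E_def
      proof (rule solves_linear_stability[OF bb _ \<kappa> a A_le y y' _ _ t])
        show "(\<lambda>t. d + norm (v k t)) integrable_on {0..T}"
          by (intro integrable_add v) auto
        fix q assume q: "q \<in> {0..T}"
        have "norm (D k q + v k q) \<le> d + norm (v k q)"
          using elim(1) q norm_triangle_ineq[of "D k q" "v k q"] by force
        then show "norm ((A (\<theta> k) q - A \<theta>' q) *v y' q + (s k *\<^sub>R r (\<theta> k) q + v k q - s' *\<^sub>R r \<theta>' q))
            \<le> d + norm (v k q)" by (simp add: D_def algebra_simps)
      qed (use T in auto)
      also have "integral {0..T} (\<lambda>t. d + norm (v k t)) = d * T + integral {0..T} (\<lambda>t. norm (v k t))"
        using T by (subst integral_add) (auto intro: v)
      also have "2 * (norm (x k - x') + (d * T + integral {0..T} (\<lambda>t. norm (v k t)))) * E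
          < 2 * (d + d * T) * E"
        using elim(2) E by simp
      also have "\<dots> = 2 * (d * (1 + T)) * E" by (simp add: algebra_simps)
      also have "d * (1 + T) = e / (4 * E)" using T by (simp only: d_def) simp
      also have "2 * (e / (4 * E)) * E = e / 2" using E by simp
      finally show "dist (y k t) (y' t) < e" using e by (simp add: dist_norm)
    qed
  qed
qed

subsection \<open>Square-integrable functions and the cost\<close>

lemma L2_on_measurable: "u \<in> L2_on T \<Longrightarrow> set_borel_measurable lborel {0..T} u"
  and L2_on_integrable_norm2: "u \<in> L2_on T \<Longrightarrow> set_integrable lborel {0..T} (\<lambda>t. (norm (u t))\<^sup>2)"
  by (simp_all add: L2_on_def)

lemma continuous_on_imp_L2_on:
  assumes "continuous_on {0..T} u" shows "u \<in> L2_on T"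
proof -
  have "set_integrable lborel {0..T} u" "set_integrable lborel {0..T} (\<lambda>t. (norm (u t))\<^sup>2)"
    by (intro borel_integrable_atLeastAtMost' continuous_intros assms)+
  then show ?thesis
    unfolding L2_on_def set_integrable_def set_borel_measurable_def by auto
qed

lemma set_integrable_const_Icc: "set_integrable lborel {0..T::real} (\<lambda>_. c::real)"
  by (intro borel_integrable_atLeastAtMost' continuous_intros)

lemma Linf_on_imp_L2_on:
  assumes "y \<in> Linf_on T" shows "y \<in> L2_on T"
proof -
  obtain B where m: "set_borel_measurable lborel {0..T} y"
    and B: "AE t in lborel. t \<in> {0..T} \<longrightarrow> norm (y t) \<le> B"
    using assms unfolding Linf_on_def by blast
  \<comment> \<open>Measurability is known only for the truncated function, so the indicator starts
    inside the norm and is moved out afterwards.\<close>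
  have "(\<lambda>t. (norm (indicator {0..T} t *\<^sub>R y t))\<^sup>2) \<in> borel_measurable lborel"
    using m unfolding set_borel_measurable_def by measurable
  also have "(\<lambda>t. (norm (indicator {0..T} t *\<^sub>R y t))\<^sup>2) = (\<lambda>t. indicator {0..T} t *\<^sub>R (norm (y t))\<^sup>2)"
    by (auto simp: indicator_def)
  finally have "set_borel_measurable lborel {0..T} (\<lambda>t. (norm (y t))\<^sup>2)"
    unfolding set_borel_measurable_def .
  moreover have "AE t in lborel. t \<in> {0..T} \<longrightarrow> norm ((norm (y t))\<^sup>2) \<le> norm (B\<^sup>2)"
    using B by eventually_elim (auto intro: power_mono)
  ultimately have "set_integrable lborel {0..T} (\<lambda>t. (norm (y t))\<^sup>2)"
    by (rule set_integrable_bound[OF set_integrable_const_Icc])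
  with m show ?thesis by (simp add: L2_on_def)
qed

text \<open>A pointwise substitute for the triangle inequality in L^2, from which both the
  integrability of squared differences and the perturbation bound for the cost follow.\<close>

lemma norm_add_power2_le: "(norm (a + b))\<^sup>2 \<le> 2 * (norm a)\<^sup>2 + 2 * (norm b)\<^sup>2"
proof -
  have "(norm (a + b))\<^sup>2 \<le> (norm a + norm b)\<^sup>2"
    by (intro power_mono norm_triangle_ineq) auto
  also have "\<dots> \<le> 2 * (norm a)\<^sup>2 + 2 * (norm b)\<^sup>2"
    using sum_squares_bound[of "norm a" "norm b"] by (simp add: power2_sum)
  finally show ?thesis .
qed

lemma L2_on_diff:
  assumes u: "u \<in> L2_on T" and v: "v \<in> L2_on T"
  shows "(\<lambda>t. u t - v t) \<in> L2_on T"
proof -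
  have m: "set_borel_measurable lborel {0..T} (\<lambda>t. u t - v t)"
    using L2_on_measurable[OF u] L2_on_measurable[OF v]
    unfolding set_borel_measurable_def scaleR_diff_right by (rule borel_measurable_diff)
  have "(\<lambda>t. (norm (indicator {0..T} t *\<^sub>R (u t - v t)))\<^sup>2) \<in> borel_measurable lborel"
    using m unfolding set_borel_measurable_def by measurable
  also have "(\<lambda>t. (norm (indicator {0..T} t *\<^sub>R (u t - v t)))\<^sup>2)
      = (\<lambda>t. indicator {0..T} t *\<^sub>R (norm (u t - v t))\<^sup>2)"
    by (auto simp: indicator_def)
  finally have "set_borel_measurable lborel {0..T} (\<lambda>t. (norm (u t - v t))\<^sup>2)"
    unfolding set_borel_measurable_def .
  then have "set_integrable lborel {0..T} (\<lambda>t. (norm (u t - v t))\<^sup>2)"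
  proof (rule set_integrable_bound[rotated])
    show "set_integrable lborel {0..T} (\<lambda>t. 2 * (norm (u t))\<^sup>2 + 2 * (norm (v t))\<^sup>2)"
      using L2_on_integrable_norm2[OF u] L2_on_integrable_norm2[OF v] by (intro set_integral_add) auto
    show "AE t in lborel. t \<in> {0..T} \<longrightarrow> norm ((norm (u t - v t))\<^sup>2)
        \<le> norm (2 * (norm (u t))\<^sup>2 + 2 * (norm (v t))\<^sup>2)"
    proof (intro AE_I2 impI)
      fix t show "norm ((norm (u t - v t))\<^sup>2) \<le> norm (2 * (norm (u t))\<^sup>2 + 2 * (norm (v t))\<^sup>2)"
        using norm_add_power2_le[of "u t" "- v t"] by simp
    qed
  qed
  with m show ?thesis by (simp add: L2_on_def)
qed

text \<open>Either the norm is at most \<open>\<eta>\<close>, or a factor \<open>\<eta>\<close> may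
  be replaced by a second norm. Integrated over \<open>{0..T}\<close>, this stands in for
  Cauchy-Schwarz once \<open>\<eta>\<close> is taken of the order of the bound on the L^2
  norm.\<close>

lemma norm_le_weighted_power2:
  assumes "\<eta> > 0" shows "norm a \<le> \<eta> + (norm a)\<^sup>2 / \<eta>"
proof (cases "norm a \<le> \<eta>")
  case False
  then have "norm a * \<eta> \<le> norm a * norm a" by (intro mult_left_mono) auto
  then have "norm a \<le> (norm a)\<^sup>2 / \<eta>" using assms by (simp add: field_simps power2_eq_square)
  then show ?thesis using assms by simp
qed (use assms in \<open>simp add: add_increasing2\<close>)

lemma L2_on_integrable:
  assumes u: "u \<in> L2_on T" shows "set_integrable lborel {0..T} u"
proof (rule set_integrable_bound[OF _ L2_on_measurable[OF u]])
  show "set_integrable lborel {0..T} (\<lambda>t. 1 + (norm (u t))\<^sup>2)"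
    using set_integrable_const_Icc L2_on_integrable_norm2[OF u] by (rule set_integral_add)
  show "AE t in lborel. t \<in> {0..T} \<longrightarrow> norm (u t) \<le> norm (1 + (norm (u t))\<^sup>2)"
  proof (intro AE_I2 impI)
    fix t show "norm (u t) \<le> norm (1 + (norm (u t))\<^sup>2)"
      using norm_le_weighted_power2[of 1 "u t"] by simp
  qed
qed

lemma L2_on_norm_integral_le:
  assumes u: "u \<in> L2_on T" and T: "T \<ge> 0" and \<eta>: "\<eta> > 0"
  shows "(\<lambda>t. norm (u t)) integrable_on {0..T}"
    and "integral {0..T} (\<lambda>t. norm (u t)) \<le> \<eta> * T + (LINT t:{0..T}|lborel. (norm (u t))\<^sup>2) / \<eta>"
proof -
  have n: "set_integrable lborel {0..T} (\<lambda>t. norm (u t))"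
    using L2_on_integrable[OF u] by (rule set_integrable_norm)
  then show "(\<lambda>t. norm (u t)) integrable_on {0..T}" by (rule set_borel_integral_eq_integral)
  have "integral {0..T} (\<lambda>t. norm (u t)) = (LINT t:{0..T}|lborel. norm (u t))"
    by (rule set_borel_integral_eq_integral(2)[OF n, symmetric])
  also have "\<dots> \<le> (LINT t:{0..T}|lborel. \<eta> + (norm (u t))\<^sup>2 / \<eta>)"
    using L2_on_integrable_norm2[OF u] \<eta>
    by (intro set_integral_mono n set_integral_add set_integrable_const_Icc norm_le_weighted_power2)
      auto
  also have "\<dots> = \<eta> * T + (LINT t:{0..T}|lborel. (norm (u t))\<^sup>2) / \<eta>"
    using L2_on_integrable_norm2[OF u] \<eta> T
    by (subst set_integral_add) (auto simp: set_integrable_const_Icc set_integral_const)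
  finally show "integral {0..T} (\<lambda>t. norm (u t)) \<le> \<eta> * T + (LINT t:{0..T}|lborel. (norm (u t))\<^sup>2) / \<eta>" .
qed

lemma set_LINT_nonneg:
  fixes f :: "real \<Rightarrow> real"
  assumes "\<And>t. f t \<ge> 0" shows "0 \<le> (LINT t:{0..T}|lborel. f t)"
  unfolding set_lebesgue_integral_def using assms by (intro integral_nonneg_AE) auto

lemma L2norm_on_power2: "(L2norm_on T y)\<^sup>2 = (LINT t:{0..T}|lborel. (norm (y t))\<^sup>2)"
  unfolding L2norm_on_def by (simp add: set_LINT_nonneg)

subsection \<open>The controlled system\<close>

text \<open>Only one parameter is fixed; the locale is interpreted at the true parameter, at the
  limit of a sequence of parameters and at the estimate.\<close>

locale linear_system =
  fixes T :: real and A :: "'p \<Rightarrow> real \<Rightarrow> real^'d^'d" and r :: "'p \<Rightarrow> real \<Rightarrow> real^'d" and \<theta> :: 'p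
  assumes T: "T > 0" and A: "continuous_on {0..T} (A \<theta>)" and r: "continuous_on {0..T} (r \<theta>)"
begin

lemma solves_linear_ex1:
  assumes "u \<in> L2_on T"
  shows "\<exists>!y. solves_linear (*v) T (A \<theta>) (\<lambda>s. r \<theta> s + u s) x0 y \<and> (\<forall>t. t \<notin> {0..T} \<longrightarrow> y t = 0)"
proof -
  have "u integrable_on {0..T}"
    using L2_on_integrable[OF assms] by (rule set_borel_integral_eq_integral)
  then show ?thesis
    using T by (intro solves_linear_ex1_zero_outside bounded_bilinear_matrix_vector_mult A
        integrable_add integrable_continuous_real[OF r]) auto
qed

lemma Xsol_eq: "Xsol T A r \<theta> x0 u =
    (THE y. solves_linear (*v) T (A \<theta>) (\<lambda>s. r \<theta> s + u s) x0 y \<and> (\<forall>t. t \<notin> {0..T} \<longrightarrow> y t = 0))"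
  unfolding Xsol_def solves_linear_def by (simp add: add.assoc conj_assoc)

lemma Xsol_solves:
  assumes "u \<in> L2_on T"
  shows "solves_linear (*v) T (A \<theta>) (\<lambda>s. r \<theta> s + u s) x0 (Xsol T A r \<theta> x0 u)"
    and "t \<notin> {0..T} \<Longrightarrow> Xsol T A r \<theta> x0 u t = 0"
  using theI'[OF solves_linear_ex1[OF assms, of x0]] unfolding Xsol_eq by blast+

lemma zero_in_L2: "(\<lambda>_. 0) \<in> L2_on T"
  by (intro continuous_on_imp_L2_on continuous_intros)

lemma Xsol_zero_eqI:
  assumes "solves_linear (*v) T (A \<theta>) (r \<theta>) x0 y" and "t \<in> {0..T}"
  shows "Xsol T A r \<theta> x0 (\<lambda>_. 0) t = y t"
  using solves_linear_unique[OF bounded_bilinear_matrix_vector_mult _ A _ _ assms(2)]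
    Xsol_solves(1)[OF zero_in_L2, of x0] assms(1) T by auto

lemma Xsol_cont:
  assumes "u \<in> L2_on T" shows "continuous_on {0..T} (Xsol T A r \<theta> x0 u)"
  using Xsol_solves(1)[OF assms] by (simp add: solves_linear_def)

section \<open>The resolvent and the observability Gramian\<close>

lemma Phi0_solves: "solves_linear (**) T (A \<theta>) (\<lambda>_. 0) (mat 1) (Phi0 T A \<theta>)"
proof -
  have "\<exists>!F. solves_linear (**) T (A \<theta>) (\<lambda>_. 0) (mat 1) F \<and> (\<forall>t. t \<notin> {0..T} \<longrightarrow> F t = 0)"
    using T by (intro solves_linear_ex1_zero_outside bounded_bilinear_matrix_matrix_mult A) auto
  moreover have "Phi0 T A \<theta> =
    (THE F. solves_linear (**) T (A \<theta>) (\<lambda>_. 0) (mat 1) F \<and> (\<forall>t. t \<notin> {0..T} \<longrightarrow> F t = 0))"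
    unfolding Phi0_def solves_linear_def by (simp add: conj_assoc)
  ultimately show ?thesis
    using theI'[of "\<lambda>F. solves_linear (**) T (A \<theta>) (\<lambda>_. 0) (mat 1) F \<and> (\<forall>t. t \<notin> {0..T} \<longrightarrow> F t = 0)"]
    by simp
qed

lemma Phi0_mult_vector_solves:
  "solves_linear (*v) T (A \<theta>) (\<lambda>_. 0) z (\<lambda>t. Phi0 T A \<theta> t *v z)"
proof -
  have bl: "bounded_linear (\<lambda>M :: real^'d^'d. M *v z)"
    by (rule bounded_bilinear.bounded_linear_left[OF bounded_bilinear_matrix_vector_mult])
  have "((\<lambda>s. A \<theta> s *v (Phi0 T A \<theta> s *v z) + 0) has_integral Phi0 T A \<theta> t *v z - z) {0..t}"
    if "t \<in> {0..T}" for t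
  proof -
    have "((\<lambda>s. A \<theta> s ** Phi0 T A \<theta> s) has_integral Phi0 T A \<theta> t - mat 1) {0..t}"
      using Phi0_solves that by (simp add: solves_linear_def)
    from has_integral_linear[OF this bl] show ?thesis
      by (simp add: o_def matrix_vector_mul_assoc matrix_vector_mult_diff_rdistrib)
  qed
  moreover have "continuous_on {0..T} (\<lambda>t. Phi0 T A \<theta> t *v z)"
    using Phi0_solves by (intro continuous_intros) (simp add: solves_linear_def)
  ultimately show ?thesis by (simp add: solves_linear_def)
qed

text \<open>Uniqueness identifies y with the resolvent applied to z. The Gramian applied to z is
  then the integral of a matrix function applied to C y, hence 0, and a left inverse of the Gramian
  finishes.\<close>

lemma observable:
  assumes inv: "invertible (Obs T C A \<theta>)"
    and y: "solves_linear (*v) T (A \<theta>) (\<lambda>_. 0) z y"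
    and Cy: "\<And>t. t \<in> {0..T} \<Longrightarrow> C *v y t = 0"
  shows "z = 0"
proof -
  let ?F = "\<lambda>t. transpose (Phi0 T A \<theta> t) ** transpose C ** C ** Phi0 T A \<theta> t"
  have bl: "bounded_linear (\<lambda>M :: real^'d^'d. M *v z)"
    by (rule bounded_bilinear.bounded_linear_left[OF bounded_bilinear_matrix_vector_mult])
  have Phi0: "continuous_on {0..T} (Phi0 T A \<theta>)" using Phi0_solves by (simp add: solves_linear_def)
  have "linear (transpose :: real^'d^'d \<Rightarrow> real^'d^'d)"
    by (rule linearI) (simp_all add: transpose_def vec_eq_iff)
  then have "continuous_on {0..T} (\<lambda>t. transpose (Phi0 T A \<theta> t))"
    by (rule linear_continuous_on_compose[OF Phi0])
  then have "continuous_on {0..T} ?F"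
    by (intro continuous_intros Phi0)
  then have "?F integrable_on {0..T}" by (rule integrable_continuous_real)
  then have "Obs T C A \<theta> *v z = integral {0..T} (\<lambda>t. ?F t *v z)"
    using integral_linear[OF _ bl, of ?F "{0..T}"] by (simp add: Obs_def o_def)
  also have "\<dots> = integral {0..T} (\<lambda>t. 0)"
  proof (rule integral_cong)
    fix t assume t: "t \<in> {0..T}"
    have "Phi0 T A \<theta> t *v z = y t"
      using solves_linear_unique[OF bounded_bilinear_matrix_vector_mult _ A Phi0_mult_vector_solves y t] T by simp
    then have "C *v (Phi0 T A \<theta> t *v z) = 0" using Cy[OF t] by simp
    then show "?F t *v z = 0" by (simp add: matrix_vector_mul_assoc[symmetric])
  qed
  finally have "Obs T C A \<theta> *v z = 0" by simp
  moreover obtain B where "B ** Obs T C A \<theta> = mat 1"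
    using inv unfolding invertible_def by blast
  ultimately show ?thesis
    using matrix_vector_mul_assoc[of B "Obs T C A \<theta>" z] by simp
qed

section \<open>The cost, its perturbation in the signal and its infimum\<close>

text \<open>Integrability is recorded along with the splitting because the Lebesgue integral of a
  non-integrable function is 0 by convention, so comparing costs without it could fail.\<close>

lemma cost_eq:
  assumes Y: "Y \<in> L2_on T" and u: "u \<in> L2_on T" and lam: "lam > 0"
  shows "cost T C A r Y \<theta> lam x0 u = (LINT t:{0..T}|lborel. (norm (Y t - C *v Xsol T A r \<theta> x0 u t))\<^sup>2)
      + lam * (LINT t:{0..T}|lborel. (norm (u t))\<^sup>2)"
    and "set_integrable lborel {0..T} (\<lambda>t. (norm (Y t - C *v Xsol T A r \<theta> x0 u t))\<^sup>2)"
    and "set_integrable lborel {0..T} (\<lambda>t. (norm (Y t - C *v Xsol T A r \<theta> x0 u t))\<^sup>2 + lam * (norm (u t))\<^sup>2)"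
proof -
  have "(\<lambda>t. C *v Xsol T A r \<theta> x0 u t) \<in> L2_on T"
    by (intro continuous_on_imp_L2_on continuous_intros Xsol_cont u)
  then show 1: "set_integrable lborel {0..T} (\<lambda>t. (norm (Y t - C *v Xsol T A r \<theta> x0 u t))\<^sup>2)"
    by (intro L2_on_integrable_norm2 L2_on_diff Y)
  have 2: "set_integrable lborel {0..T} (\<lambda>t. lam * (norm (u t))\<^sup>2)"
    using L2_on_integrable_norm2[OF u] by simp
  show "cost T C A r Y \<theta> lam x0 u = (LINT t:{0..T}|lborel. (norm (Y t - C *v Xsol T A r \<theta> x0 u t))\<^sup>2)
      + lam * (LINT t:{0..T}|lborel. (norm (u t))\<^sup>2)"
    unfolding cost_def by (subst set_integral_add(2)[OF 1 2]) simp
  show "set_integrable lborel {0..T} (\<lambda>t. (norm (Y t - C *v Xsol T A r \<theta> x0 u t))\<^sup>2 + lam * (norm (u t))\<^sup>2)"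
    using 1 2 by (rule set_integral_add)
qed

text \<open>The squared triangle inequality through Y; doubling the nonnegative penalty only
  enlarges the right-hand side. The error term contains neither \<open>x0\<close> nor
  \<open>u\<close>, so the bound survives the infimum over both.\<close>

lemma cost_perturb:
  assumes Y: "Y \<in> L2_on T" and Z: "Z \<in> L2_on T" and u: "u \<in> L2_on T" and lam: "lam > 0"
  shows "cost T C A r Z \<theta> lam x0 u \<le> 2 * cost T C A r Y \<theta> lam x0 u + 2 * (L2norm_on T (\<lambda>t. Y t - Z t))\<^sup>2"
proof -
  have i: "set_integrable lborel {0..T} (\<lambda>t. (norm (Y t - Z t))\<^sup>2)"
    by (intro L2_on_integrable_norm2 L2_on_diff Y Z)
  note c = cost_eq(3)[OF Y u lam, of C x0]
  have "cost T C A r Z \<theta> lam x0 u \<le> (LINT t:{0..T}|lborel.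
      2 * ((norm (Y t - C *v Xsol T A r \<theta> x0 u t))\<^sup>2 + lam * (norm (u t))\<^sup>2) + 2 * (norm (Y t - Z t))\<^sup>2)"
    unfolding cost_def
  proof (intro set_integral_mono cost_eq(3)[OF Z u lam] set_integral_add)
    show "set_integrable lborel {0..T}
        (\<lambda>t. 2 * ((norm (Y t - C *v Xsol T A r \<theta> x0 u t))\<^sup>2 + lam * (norm (u t))\<^sup>2))"
      using c by (rule set_integrable_mult_right)
    show "set_integrable lborel {0..T} (\<lambda>t. 2 * (norm (Y t - Z t))\<^sup>2)"
      using i by simp
    fix t
    have "(norm (Z t - C *v Xsol T A r \<theta> x0 u t))\<^sup>2
        \<le> 2 * (norm (Y t - C *v Xsol T A r \<theta> x0 u t))\<^sup>2 + 2 * (norm (Y t - Z t))\<^sup>2"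
      using norm_add_power2_le[of "Y t - C *v Xsol T A r \<theta> x0 u t" "Z t - Y t"]
      by (simp add: norm_minus_commute)
    moreover have "0 \<le> lam * (norm (u t))\<^sup>2" using lam by simp
    ultimately show "(norm (Z t - C *v Xsol T A r \<theta> x0 u t))\<^sup>2 + lam * (norm (u t))\<^sup>2
        \<le> 2 * ((norm (Y t - C *v Xsol T A r \<theta> x0 u t))\<^sup>2 + lam * (norm (u t))\<^sup>2) + 2 * (norm (Y t - Z t))\<^sup>2"
      by (simp only: distrib_left)
  qed
  also have "\<dots> = 2 * cost T C A r Y \<theta> lam x0 u + 2 * (L2norm_on T (\<lambda>t. Y t - Z t))\<^sup>2"
    unfolding cost_def L2norm_on_power2
    using set_integral_add(2)[OF set_integrable_mult_right[OF c, of 2] set_integrable_mult_right[OF i, of 2]]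
    by (simp only: set_integral_mult_right)
  finally show ?thesis .
qed

lemma cost_nonneg: "lam > 0 \<Longrightarrow> 0 \<le> cost T C A r Y \<theta> lam x0 u"
  unfolding cost_def by (intro set_LINT_nonneg) auto

lemma Sfun_le:
  assumes lam: "lam > 0" and u: "u \<in> L2_on T"
  shows "Sfun T C A r Y \<theta> lam \<le> cost T C A r Y \<theta> lam x0 u"
proof -
  \<comment> \<open>The outer infimum lies below each inner one only if the inner ones are bounded
    below; nonnegativity of the cost supplies this at both levels.\<close>
  have inner: "(INF u\<in>L2_on T. cost T C A r Y \<theta> lam x u) \<ge> 0" for x
    using zero_in_L2 by (intro cINF_greatest cost_nonneg lam) auto
  have "Sfun T C A r Y \<theta> lam \<le> (INF u\<in>L2_on T. cost T C A r Y \<theta> lam x0 u)"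
    unfolding Sfun_def 
    by (rule cINF_lower[OF bdd_belowI2[OF inner] UNIV_I])
  also have "\<dots> \<le> cost T C A r Y \<theta> lam x0 u"
    by (rule cINF_lower[OF bdd_belowI2[OF cost_nonneg[OF lam]] u])
  finally show ?thesis .
qed

lemma Sfun_ge:
  assumes "\<And>x0 u. u \<in> L2_on T \<Longrightarrow> c \<le> cost T C A r Y \<theta> lam x0 u"
  shows "c \<le> Sfun T C A r Y \<theta> lam"
  unfolding Sfun_def using zero_in_L2 assms by (intro cINF_greatest) auto

end

subsection \<open>Consistency\<close>

text \<open>The gap is stated for each initial value and control instead of for \<open>Sfun\<close>,
  because \<open>cost_perturb\<close> exchanges the exact signal for the estimate at that
  level.\<close>

lemma cost_gap:
  fixes C :: "real^'d^'d'" and A :: "'p::metric_space \<Rightarrow> real \<Rightarrow> real^'d^'d"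
  assumes T: "T > 0" and lam: "lam > 0" and \<Theta>: "compact \<Theta>" and \<theta>s: "\<theta>s \<in> \<Theta>"
    and obs: "\<And>\<theta>. \<theta> \<in> \<Theta> \<Longrightarrow> invertible (Obs T C A \<theta>)"
    and ident: "\<And>\<theta> x0. \<theta> \<in> \<Theta> \<Longrightarrow>
      (\<lambda>t. C *v Xsol T A r \<theta> x0 (\<lambda>_. 0) t) = (\<lambda>t. C *v Xsol T A r \<theta>s x0s (\<lambda>_. 0) t) \<Longrightarrow> \<theta> = \<theta>s"
    and A: "continuous_on ({0..T} \<times> \<Theta>) (\<lambda>(t, \<theta>). A \<theta> t)"
    and r: "continuous_on ({0..T} \<times> \<Theta>) (\<lambda>(t, \<theta>). r \<theta> t)"
    and \<epsilon>: "\<epsilon> > 0"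
  shows "\<exists>\<delta>>0. \<forall>\<theta>\<in>\<Theta>. \<epsilon> \<le> dist \<theta> \<theta>s \<longrightarrow> (\<forall>x0. \<forall>u\<in>L2_on T.
    \<delta> \<le> cost T C A r (\<lambda>t. C *v Xsol T A r \<theta>s x0s (\<lambda>_. 0) t) \<theta> lam x0 u)"
proof (rule ccontr)
  define Ys where "Ys = (\<lambda>t. C *v Xsol T A r \<theta>s x0s (\<lambda>_. 0) t)"
  note bb = bounded_bilinear_matrix_vector_mult
  have sys: "linear_system T A r \<theta>" if "\<theta> \<in> \<Theta>" for \<theta>
    using that T continuous_on_parameter_section[OF A] continuous_on_parameter_section[OF r]
    by unfold_locales auto
  interpret true: linear_system T A r \<theta>s by (rule sys[OF \<theta>s])
  have Ys_cont: "continuous_on {0..T} Ys"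
    unfolding Ys_def by (intro continuous_intros true.Xsol_cont true.zero_in_L2)
  then have Ys_L2: "Ys \<in> L2_on T" by (rule continuous_on_imp_L2_on)
  \<comment> \<open>The square of \<open>b k\<close> bounds the k-th cost, and \<open>b k\<close>
    itself is later the weight \<open>\<eta>\<close> in the L^1 estimate of the control, which makes
    both terms of that estimate of order \<open>b k\<close>.\<close>
  define b where "b k = inverse (real (Suc k))" for k
  have b: "b k > 0" for k by (simp add: b_def)
  assume contr: "\<not> ?thesis"
  have "\<exists>\<theta> x0 u. \<theta> \<in> \<Theta> \<and> \<epsilon> \<le> dist \<theta> \<theta>s \<and> u \<in> L2_on T \<and> cost T C A r Ys \<theta> lam x0 u < (b k)\<^sup>2" for k
  proof (rule ccontr)
    assume "\<not> ?thesis"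
    then have "\<forall>\<theta>\<in>\<Theta>. \<epsilon> \<le> dist \<theta> \<theta>s \<longrightarrow> (\<forall>x0. \<forall>u\<in>L2_on T. (b k)\<^sup>2 \<le> cost T C A r Ys \<theta> lam x0 u)"
      by (meson not_less)
    moreover have "(b k)\<^sup>2 > 0" using b[of k] by simp
    ultimately show False using contr unfolding Ys_def by blast
  qed
  then obtain \<theta> x u where \<theta>: "\<And>k. \<theta> k \<in> \<Theta>" and far: "\<And>k. \<epsilon> \<le> dist (\<theta> k) \<theta>s"
    and u: "\<And>k. u k \<in> L2_on T" and small: "\<And>k. cost T C A r Ys (\<theta> k) lam (x k) (u k) < (b k)\<^sup>2"
    by metis
  \<comment> \<open>The initial values may be unbounded; the rescaled triples below stay in a compact set with s + |z| = 1.\<close>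
  define s where "s k = 1 / (1 + norm (x k))" for k
  have pos: "1 + norm (x k) > 0" for k by (simp add: add_pos_nonneg)
  have s: "0 \<le> s k" "s k \<le> 1" for k unfolding s_def using pos[of k] by simp_all
  have sum1: "s k + norm (s k *\<^sub>R x k) = 1" for k
  proof -
    have "s k * (1 + norm (x k)) = 1" unfolding s_def using pos[of k] by simp
    then show ?thesis using s(1)[of k] by (simp add: distrib_left)
  qed
  have "compact (\<Theta> \<times> {0..1::real} \<times> cball (0::real^'d) 1)"
    by (intro compact_Times \<Theta> compact_Icc compact_cball)
  moreover have "norm (s k *\<^sub>R x k) \<le> 1" for k using sum1[of k] s[of k] by linarith
  then have "\<forall>k. (\<theta> k, s k, s k *\<^sub>R x k) \<in> \<Theta> \<times> {0..1} \<times> cball 0 1"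
    using \<theta> s by (simp del: norm_scaleR)
  ultimately obtain l \<phi> where l: "l \<in> \<Theta> \<times> {0..1} \<times> cball (0::real^'d) 1" and \<phi>: "strict_mono (\<phi> :: nat \<Rightarrow> nat)"
    and lim: "((\<lambda>k. (\<theta> k, s k, s k *\<^sub>R x k)) \<circ> \<phi>) \<longlonglongrightarrow> l"
    by (meson seq_compactE compact_imp_seq_compact)
  obtain \<theta>' s' z' where l_eq: "l = (\<theta>', s', z')" by (cases l) auto
  have \<theta>': "\<theta>' \<in> \<Theta>" and s': "0 \<le> s'" using l by (auto simp: l_eq)
  have lim_\<theta>: "(\<lambda>k. \<theta> (\<phi> k)) \<longlonglongrightarrow> \<theta>'" and lim_s: "(\<lambda>k. s (\<phi> k)) \<longlonglongrightarrow> s'"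
    and lim_z: "(\<lambda>k. s (\<phi> k) *\<^sub>R x (\<phi> k)) \<longlonglongrightarrow> z'"
    using tendsto_fst[OF lim] tendsto_fst[OF tendsto_snd[OF lim]] tendsto_snd[OF tendsto_snd[OF lim]]
    by (simp_all add: l_eq o_def)
  have lim_b: "(\<lambda>k. b (\<phi> k)) \<longlonglongrightarrow> 0"
    using LIMSEQ_subseq_LIMSEQ[OF LIMSEQ_inverse_real_of_nat \<phi>] by (simp add: b_def[abs_def] o_def)
  have sum1': "s' + norm z' = 1"
    using tendsto_add[OF lim_s tendsto_norm[OF lim_z]] unfolding sum1 by (simp add: LIMSEQ_const_iff)
  interpret lim: linear_system T A r \<theta>' by (rule sys[OF \<theta>'])
  define y where "y k t = s k *\<^sub>R Xsol T A r (\<theta> k) (x k) (u k) t" for k t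
  have y: "solves_linear (*v) T (A (\<theta> k)) (\<lambda>t. s k *\<^sub>R r (\<theta> k) t + s k *\<^sub>R u k t) (s k *\<^sub>R x k) (y k)" for k
    using solves_linear_scaleR[OF bb linear_system.Xsol_solves(1)[OF sys[OF \<theta>[of k]] u[of k], of "x k"], of "s k"]
    by (simp add: y_def[abs_def] scaleR_add_right)
  have "(\<lambda>t. s' *\<^sub>R r \<theta>' t) integrable_on {0..T}"
    by (intro integrable_continuous_real continuous_intros lim.r)
  \<comment> \<open>The limit trajectory is built from its own equation and not extracted from the
    sequence, so compactness is used only for the triples of parameter, factor and initial
    value.\<close>
  then obtain y' where y': "solves_linear (*v) T (A \<theta>') (\<lambda>t. s' *\<^sub>R r \<theta>' t) z' y'"
    using solves_linear_exists[OF bb _ lim.A] T by (metis less_imp_le)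
  have cost_k: "(LINT t:{0..T}|lborel. (norm (Ys t - C *v Xsol T A r (\<theta> k) (x k) (u k) t))\<^sup>2) \<le> (b k)\<^sup>2"
    "(LINT t:{0..T}|lborel. (norm (u k t))\<^sup>2) \<le> (b k)\<^sup>2 / lam" for k
  proof -
    have "0 \<le> (LINT t:{0..T}|lborel. (norm (Ys t - C *v Xsol T A r (\<theta> k) (x k) (u k) t))\<^sup>2)"
      and "0 \<le> lam * (LINT t:{0..T}|lborel. (norm (u k t))\<^sup>2)"
      using lam by (auto intro!: set_LINT_nonneg mult_nonneg_nonneg)
    then have "(LINT t:{0..T}|lborel. (norm (Ys t - C *v Xsol T A r (\<theta> k) (x k) (u k) t))\<^sup>2) \<le> (b k)\<^sup>2
      \<and> lam * (LINT t:{0..T}|lborel. (norm (u k t))\<^sup>2) \<le> (b k)\<^sup>2"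
      using small[of k] linear_system.cost_eq(1)[OF sys[OF \<theta>[of k]] Ys_L2 u[of k] lam, of C "x k"] by linarith
    then show "(LINT t:{0..T}|lborel. (norm (Ys t - C *v Xsol T A r (\<theta> k) (x k) (u k) t))\<^sup>2) \<le> (b k)\<^sup>2"
      "(LINT t:{0..T}|lborel. (norm (u k t))\<^sup>2) \<le> (b k)\<^sup>2 / lam"
      using lam by (auto simp: field_simps)
  qed
  have u_int: "(\<lambda>t. norm (s k *\<^sub>R u k t)) integrable_on {0..T}" for k
    using L2_on_norm_integral_le(1)[OF u[of k] _ b[of k]] T by (auto intro!: integrable_on_mult_right)
  have "integral {0..T} (\<lambda>t. norm (s k *\<^sub>R u k t)) \<le> b k * (T + 1 / lam)" for k
  proof -
    have nn: "0 \<le> integral {0..T} (\<lambda>t. norm (u k t))"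
      using L2_on_norm_integral_le(1)[OF u[of k] _ b[of k]] T by (intro integral_nonneg) auto
    have "integral {0..T} (\<lambda>t. norm (s k *\<^sub>R u k t)) = s k * integral {0..T} (\<lambda>t. norm (u k t))"
      using s[of k] by simp
    also have "\<dots> \<le> 1 * integral {0..T} (\<lambda>t. norm (u k t))"
      using s[of k] nn by (intro mult_right_mono) auto
    also have "\<dots> \<le> b k * T + (LINT t:{0..T}|lborel. (norm (u k t))\<^sup>2) / b k"
      using L2_on_norm_integral_le(2)[OF u[of k] _ b[of k]] T by simp
    also have "\<dots> \<le> b k * T + ((b k)\<^sup>2 / lam) / b k"
      using cost_k(2)[of k] b[of k] by (intro add_left_mono divide_right_mono) auto
    also have "\<dots> = b k * (T + 1 / lam)"
      using b[of k] by (simp add: power2_eq_square algebra_simps)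
    finally show ?thesis .
  qed
  note u_le = this
  have lim_u: "(\<lambda>k. integral {0..T} (\<lambda>t. norm (s (\<phi> k) *\<^sub>R u (\<phi> k) t))) \<longlonglongrightarrow> 0"
  proof (rule tendsto_sandwich[OF always_eventually always_eventually tendsto_const])
    show "\<forall>k. 0 \<le> integral {0..T} (\<lambda>t. norm (s (\<phi> k) *\<^sub>R u (\<phi> k) t))"
      using integral_nonneg[OF u_int] norm_ge_zero by blast
    show "\<forall>k. integral {0..T} (\<lambda>t. norm (s (\<phi> k) *\<^sub>R u (\<phi> k) t)) \<le> b (\<phi> k) * (T + 1 / lam)"
      using u_le by blast
    show "(\<lambda>k. b (\<phi> k) * (T + 1 / lam)) \<longlonglongrightarrow> 0"
      by (rule tendsto_mult_left_zero[OF lim_b])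
  qed
  have lim_y: "uniform_limit {0..T} (\<lambda>k. y (\<phi> k)) y' sequentially"
    by (rule solves_linear_limit[OF T \<Theta> A r \<theta> \<theta>' lim_\<theta> lim_s lim_z u_int lim_u y y'])
  \<comment> \<open>Observation residuals, scaled like the trajectories: \<open>w k\<close> is s
    times (Ys - C X) for the k-th data, so its squared L^2 norm is at most the k-th cost.\<close>
  define w where "w k t = s k *\<^sub>R Ys t - C *v y k t" for k t
  define w' where "w' t = s' *\<^sub>R Ys t - C *v y' t" for t
  have y_cont: "continuous_on {0..T} (y k)" for k using y by (simp add: solves_linear_def)
  have y'_cont: "continuous_on {0..T} y'" using y' by (simp add: solves_linear_def)
  have w_cont: "continuous_on {0..T} (w k)" for k
    unfolding w_def[abs_def] by (intro continuous_intros Ys_cont y_cont)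
  have w'_cont: "continuous_on {0..T} w'"
    unfolding w'_def[abs_def] by (intro continuous_intros Ys_cont y'_cont)
  have "bounded (Ys ` {0..T})" "bounded (w' ` {0..T})"
    by (intro compact_imp_bounded compact_continuous_image compact_Icc Ys_cont w'_cont)+
  note bdd = this
  have "uniform_limit {0..T} (\<lambda>k. w (\<phi> k)) w' sequentially"
    unfolding w_def[abs_def] w'_def[abs_def]
  proof (rule uniform_limit_minus)
    show "uniform_limit {0..T} (\<lambda>k t. s (\<phi> k) *\<^sub>R Ys t) (\<lambda>t. s' *\<^sub>R Ys t) sequentially"
      using lim_s T by (intro bounded_bilinear.bounded_uniform_limit[OF bounded_bilinear_scaleR]
          uniform_limit_const bdd) (auto simp: uniform_limit_iff tendsto_iff image_constant_conv)
    show "uniform_limit {0..T} (\<lambda>k t. C *v y (\<phi> k) t) (\<lambda>t. C *v y' t) sequentially"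
      by (rule bounded_linear.uniform_limit[OF bounded_bilinear.bounded_linear_right[OF bb] lim_y])
  qed
  \<comment> \<open>The squared norm is written as an inner product so that uniform convergence
    passes through a bounded bilinear map.\<close>
  then have ww: "uniform_limit {0..T} (\<lambda>k t. w (\<phi> k) t \<bullet> w (\<phi> k) t) (\<lambda>t. w' t \<bullet> w' t) sequentially"
    by (intro bounded_bilinear.bounded_uniform_limit[OF bounded_bilinear_inner] bdd)
  have ww_cont: "continuous_on {0..T} (\<lambda>t. w (\<phi> k) t \<bullet> w (\<phi> k) t)" for k
    by (intro continuous_intros w_cont)
  obtain I J where I: "\<And>k. ((\<lambda>t. w (\<phi> k) t \<bullet> w (\<phi> k) t) has_integral I k) {0..T}"
    and J: "((\<lambda>t. w' t \<bullet> w' t) has_integral J) {0..T}" and IJ: "I \<longlonglongrightarrow> J"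
    by (rule uniform_limit_integral[OF ww ww_cont sequentially_bot]) (rule that)
  have "I k \<le> (b (\<phi> k))\<^sup>2" for k
  proof -
    let ?k = "\<phi> k"
    let ?f = "\<lambda>t. (norm (Ys t - C *v Xsol T A r (\<theta> ?k) (x ?k) (u ?k) t))\<^sup>2"
    have f: "set_integrable lborel {0..T} ?f"
      by (rule linear_system.cost_eq(2)[OF sys[OF \<theta>] Ys_L2 u lam])
    then have "(?f has_integral (LINT t:{0..T}|lborel. ?f t)) {0..T}"
      using set_borel_integral_eq_integral[OF f] by (simp add: integrable_integral)
    from has_integral_mult_right[OF this, of "(s ?k)\<^sup>2"]
    have "((\<lambda>t. w ?k t \<bullet> w ?k t) has_integral (s ?k)\<^sup>2 * (LINT t:{0..T}|lborel. ?f t)) {0..T}"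
    proof (rule has_integral_eq[rotated])
      fix t
      have "w ?k t = s ?k *\<^sub>R (Ys t - C *v Xsol T A r (\<theta> ?k) (x ?k) (u ?k) t)"
        by (simp add: w_def y_def bounded_bilinear.scaleR_right[OF bb] scaleR_diff_right)
      then show "(s ?k)\<^sup>2 * ?f t = w ?k t \<bullet> w ?k t"
        by (simp add: dot_square_norm power_mult_distrib)
    qed
    then have "I k = (s ?k)\<^sup>2 * (LINT t:{0..T}|lborel. ?f t)"
      by (rule has_integral_unique[OF I])
    also have "\<dots> \<le> 1 * (LINT t:{0..T}|lborel. ?f t)"
      using s[of ?k] by (intro mult_right_mono set_LINT_nonneg) (auto simp: power_le_one)
    finally show ?thesis using cost_k(1)[of ?k] by simp
  qed
  moreover have "(\<lambda>k. (b (\<phi> k))\<^sup>2) \<longlonglongrightarrow> 0" using tendsto_power[OF lim_b, of 2] by simp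
  ultimately have "J \<le> 0" using LIMSEQ_le[OF IJ] by blast
  moreover have "J \<ge> 0" using J by (rule has_integral_nonneg) simp
  ultimately have "integral {0..T} (\<lambda>t. w' t \<bullet> w' t) = 0" using J by (simp add: integral_unique)
  \<comment> \<open>Continuity of w' upgrades a vanishing integral to vanishing at every time of
    \<open>{0..T}\<close>; identifiability and \<open>observable\<close> both ask for pointwise
    equality.\<close>
  then have w'0: "\<forall>t\<in>{0..T}. w' t \<bullet> w' t = 0"
    using T by (subst (asm) integral_eq_0_iff) (auto intro!: continuous_intros w'_cont)
  have Cy': "C *v y' t = s' *\<^sub>R Ys t" if "t \<in> {0..T}" for t
    using bspec[OF w'0 that] by (simp add: w'_def)
  show False
  proof (cases "s' = 0")
    case True
    then have "z' = 0"
      using lim.observable[OF obs[OF \<theta>'], of z' y'] y' Cy' by simp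
    then show False using sum1' True by simp
  next
    case False
    then have "solves_linear (*v) T (A \<theta>') (r \<theta>') (inverse s' *\<^sub>R z') (\<lambda>t. inverse s' *\<^sub>R y' t)"
      using solves_linear_scaleR[OF bb y', of "inverse s'"] by simp
    note X = lim.Xsol_zero_eqI[OF this]
    \<comment> \<open>Identifiability compares functions on the whole line; outside
      \<open>{0..T}\<close> both sides are C applied to the default value 0.\<close>
    have "C *v Xsol T A r \<theta>' (inverse s' *\<^sub>R z') (\<lambda>_. 0) t = Ys t" for t
    proof (cases "t \<in> {0..T}")
      case True
      then show ?thesis using X[OF True] Cy'[OF True] False
        by (simp add: bounded_bilinear.scaleR_right[OF bb])
    next
      case False
      then show ?thesis
        using lim.Xsol_solves(2)[OF lim.zero_in_L2] true.Xsol_solves(2)[OF true.zero_in_L2]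
        by (simp add: Ys_def)
    qed
    then have "\<theta>' = \<theta>s" by (intro ident[OF \<theta>' ext]) (simp add: Ys_def)
    moreover have "\<epsilon> \<le> dist \<theta>' \<theta>s"
      by (rule tendsto_lowerbound[OF tendsto_dist[OF lim_\<theta> tendsto_const]]) (use far in auto)
    ultimately show False using \<epsilon> by simp
  qed
qed

theorem mainTheorem6:
  fixes T lam :: real
    and C :: "real^'d::finite^'d'::finite"
    and \<Theta> :: "(real^'p::finite) set"
    and A :: "real^'p \<Rightarrow> real \<Rightarrow> real^'d^'d"
    and r :: "real^'p \<Rightarrow> real \<Rightarrow> real^'d"
    and \<theta>s :: "real^'p" and x0s :: "real^'d"
    and M :: "'w measure"
    and Yhat :: "nat \<Rightarrow> 'w \<Rightarrow> real \<Rightarrow> real^'d'"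
    and thetahat :: "nat \<Rightarrow> 'w \<Rightarrow> real^'p"
  assumes T_pos: "T > 0"
    and lambda_pos: "lam > 0"
    and C1: "compact \<Theta>" "\<theta>s \<in> interior \<Theta>"
    and C2a: "\<forall>\<theta>\<in>\<Theta>. invertible (Obs T C A \<theta>)"
    and C2b: "\<forall>\<theta>\<in>\<Theta>. \<forall>x0.
               (\<lambda>t. C *v Xsol T A r \<theta> x0 (\<lambda>_. 0) t) = (\<lambda>t. C *v Xsol T A r \<theta>s x0s (\<lambda>_. 0) t)
               \<longrightarrow> \<theta> = \<theta>s \<and> x0 = x0s"
    and C3: "continuous_on ({0..T} \<times> \<Theta>) (\<lambda>(t, \<theta>). A \<theta> t)"
            "continuous_on ({0..T} \<times> \<Theta>) (\<lambda>(t, \<theta>). r \<theta> t)"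
    and prob: "prob_space M"
    and Yhat_Linf: "\<forall>n. \<forall>\<omega>\<in>space M. Yhat n \<omega> \<in> Linf_on T"
    and Yhat_meas: "\<forall>n. (\<lambda>\<omega>. L2norm_on T (\<lambda>t. Yhat n \<omega> t - C *v Xsol T A r \<theta>s x0s (\<lambda>_. 0) t))
                          \<in> borel_measurable M"
    and Yhat_consistent: "\<forall>\<epsilon>>0. (\<lambda>n. measure M {\<omega>\<in>space M.
               L2norm_on T (\<lambda>t. Yhat n \<omega> t - C *v Xsol T A r \<theta>s x0s (\<lambda>_. 0) t) > \<epsilon>})
               \<longlonglongrightarrow> 0"
    and thetahat_meas: "\<forall>n. thetahat n \<in> borel_measurable M"
    and thetahat_argmin: "\<forall>n. \<forall>\<omega>\<in>space M. thetahat n \<omega> \<in> \<Theta> \<and>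
               (\<forall>\<theta>\<in>\<Theta>. Sfun T C A r (Yhat n \<omega>) (thetahat n \<omega>) lam \<le> Sfun T C A r (Yhat n \<omega>) \<theta> lam)"
  shows "\<forall>\<epsilon>>0. (\<lambda>n. measure M {\<omega>\<in>space M. dist (thetahat n \<omega>) \<theta>s > \<epsilon>}) \<longlonglongrightarrow> 0"
proof (intro allI impI)
  fix \<epsilon> :: real assume \<epsilon>: "\<epsilon> > 0"
  interpret prob_space M by (rule prob)
  define Ys where "Ys = (\<lambda>t. C *v Xsol T A r \<theta>s x0s (\<lambda>_. 0) t)"
  define e where "e n \<omega> = L2norm_on T (\<lambda>t. Yhat n \<omega> t - Ys t)" for n \<omega>
  have \<theta>s: "\<theta>s \<in> \<Theta>" using C1(2) interior_subset by blast
  have sys: "linear_system T A r \<theta>" if "\<theta> \<in> \<Theta>" for \<theta>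
    using that T_pos continuous_on_parameter_section[OF C3(1)] continuous_on_parameter_section[OF C3(2)]
    by unfold_locales auto
  interpret true: linear_system T A r \<theta>s by (rule sys[OF \<theta>s])
  have Ys_L2: "Ys \<in> L2_on T"
    unfolding Ys_def by (intro continuous_on_imp_L2_on continuous_intros true.Xsol_cont true.zero_in_L2)
  have ident: "\<theta> = \<theta>s"
    if "\<theta> \<in> \<Theta>" "(\<lambda>t. C *v Xsol T A r \<theta> x0 (\<lambda>_. 0) t) = (\<lambda>t. C *v Xsol T A r \<theta>s x0s (\<lambda>_. 0) t)" for \<theta> x0
    using C2b that by blast
  have gap_ex: "\<exists>\<delta>>0. \<forall>\<theta>\<in>\<Theta>. \<epsilon> \<le> dist \<theta> \<theta>s \<longrightarrow> (\<forall>x0. \<forall>u\<in>L2_on T.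
      \<delta> \<le> cost T C A r Ys \<theta> lam x0 u)"
    unfolding Ys_def by (rule cost_gap[OF T_pos lambda_pos C1(1) \<theta>s bspec[OF C2a] ident C3 \<epsilon>])
  then obtain \<delta> where \<delta>: "\<delta> > 0" and \<delta>_gap: "\<forall>\<theta>\<in>\<Theta>. \<epsilon> \<le> dist \<theta> \<theta>s \<longrightarrow> (\<forall>x0. \<forall>u\<in>L2_on T.
      \<delta> \<le> cost T C A r Ys \<theta> lam x0 u)"
    by (elim exE conjE)
  have gap: "\<delta> \<le> cost T C A r Ys \<theta> lam x0 u"
    if "\<theta> \<in> \<Theta>" "\<epsilon> \<le> dist \<theta> \<theta>s" "u \<in> L2_on T" for \<theta> x0 u
    using bspec[OF \<delta>_gap that(1)] that(2,3) by blast
  \<comment> \<open>Comparing the minimiser with the true parameter gives (\<open>\<delta>\<close> -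
    2 e^2) / 2 at most e^2, that is \<open>\<delta>\<close> / 4 at most e^2; taking 8 instead of 4
    makes the inequality strict.\<close>
  have "e n \<omega> > sqrt (\<delta> / 8)" if \<omega>: "\<omega> \<in> space M" and far: "dist (thetahat n \<omega>) \<theta>s > \<epsilon>" for n \<omega>
  proof -
    have in\<Theta>: "thetahat n \<omega> \<in> \<Theta>" and argmin: "Sfun T C A r (Yhat n \<omega>) (thetahat n \<omega>) lam \<le> Sfun T C A r (Yhat n \<omega>) \<theta>s lam"
      using thetahat_argmin \<omega> \<theta>s by auto
    have Y: "Yhat n \<omega> \<in> L2_on T" using Yhat_Linf \<omega> Linf_on_imp_L2_on by blast
    interpret hat: linear_system T A r "thetahat n \<omega>" by (rule sys[OF in\<Theta>])
    \<comment> \<open>This is \<open>cost_perturb\<close> solved for the cost against the estimate,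
      with the cost against \<open>Ys\<close> bounded below by the gap.\<close>
    have "(\<delta> - 2 * (e n \<omega>)\<^sup>2) / 2 \<le> Sfun T C A r (Yhat n \<omega>) (thetahat n \<omega>) lam"
    proof (rule hat.Sfun_ge)
      fix x0 :: "real^'d" and u :: "real \<Rightarrow> real^'d" assume u: "u \<in> L2_on T"
      show "(\<delta> - 2 * (e n \<omega>)\<^sup>2) / 2 \<le> cost T C A r (Yhat n \<omega>) (thetahat n \<omega>) lam x0 u"
        using hat.cost_perturb[OF Y Ys_L2 u lambda_pos, of C x0] gap[OF in\<Theta> _ u, of x0] far
        by (simp add: e_def)
    qed
    also have "\<dots> \<le> Sfun T C A r (Yhat n \<omega>) \<theta>s lam" by (rule argmin)
    also have "\<dots> \<le> cost T C A r (Yhat n \<omega>) \<theta>s lam x0s (\<lambda>_. 0)"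
      by (rule true.Sfun_le[OF lambda_pos true.zero_in_L2])
    also have "\<dots> = (e n \<omega>)\<^sup>2"
      by (simp add: cost_def e_def L2norm_on_power2 Ys_def)
    finally have "\<delta> / 8 < (e n \<omega>)\<^sup>2" using \<delta> by simp
    moreover have "e n \<omega> \<ge> 0" by (simp add: e_def L2norm_on_def set_LINT_nonneg)
    ultimately show ?thesis by (simp add: real_less_lsqrt)
  qed
  then have sub: "{\<omega>\<in>space M. dist (thetahat n \<omega>) \<theta>s > \<epsilon>} \<subseteq> {\<omega>\<in>space M. e n \<omega> > sqrt (\<delta> / 8)}" for n
    by blast
  have e_meas: "e n \<in> borel_measurable M" for n
    using Yhat_meas unfolding e_def[abs_def] Ys_def by blast
  \<comment> \<open>Monotonicity of the measure asks for the larger event to be measurable, which is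
    where \<open>Yhat_meas\<close> enters.\<close>
  have "{\<omega>\<in>space M. e n \<omega> > sqrt (\<delta> / 8)} \<in> sets M" for n
    using e_meas[of n] by measurable
  note le = finite_measure_mono[OF sub this]
  have "(\<lambda>n. measure M {\<omega>\<in>space M. e n \<omega> > sqrt (\<delta> / 8)}) \<longlonglongrightarrow> 0"
    using Yhat_consistent \<delta> unfolding e_def Ys_def by simp
  then show "(\<lambda>n. measure M {\<omega>\<in>space M. dist (thetahat n \<omega>) \<theta>s > \<epsilon>}) \<longlonglongrightarrow> 0"
    by (rule tendsto_sandwich[OF always_eventually always_eventually tendsto_const, rotated -1])
      (use le measure_nonneg in blast)+
qed

end
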